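(* Let $\Gamma$ be a finite subgroup of $\mathrm{SL}_2(\mathbb{C})$ isomorphic to the binary tetrahedral group, to the binary octahedral group or to the binary icosahedral group. Then for every $n\ge 0$ and every $I\in\mathcal{H}_n^{\mathrm{SL}_2(\mathbb{C})}$, the irreducible component of $\mathcal{H}_n^{\Gamma}$ containing $I$ has dimension $0$.
   Context: $\mathcal{H}_n$ denotes the Hilbert scheme of $n$ points in $\mathbb{C}^2$, i.e. the scheme of ideals $I\subset\mathbb{C}[x,y]$ with $\dim_{\mathbb{C}}\mathbb{C}[x,y]/I=n$. The group $\mathrm{SL}_2(\mathbb{C})$ acts linearly on $\mathbb{C}^2$, hence on $\mathbb{C}[x,y]$ and on $\mathcal{H}_n$; for a subgroup $G\subset\mathrm{SL}_2(\mathbb{C})$, $\mathcal{H}_n^G$ denotes the closed subscheme of $G$-fixed points. *)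

theory Defs
  imports
    "HOL-Analysis.Analysis"
    "HOL-Algebra.Group"
    "HOL-Computational_Algebra.Polynomial"
    "HOL-Library.Extended_Nat"
begin

section \<open>Ideals of finite colength in the polynomial ring in two variables\<close>

text \<open>
  The ring \<open>\<complex>[x,y]\<close> is represented as \<open>\<complex>[y][x]\<close>: the outer polynomial variable is \<open>x\<close>, the
  inner one is \<open>y\<close>.
\<close>

type_synonym bipoly = "complex poly poly"

definition var_x :: bipoly where "var_x = [:0, 1:]"

definition var_y :: bipoly where "var_y = [:[:0, 1:]:]"

definition scalar :: "complex \<Rightarrow> bipoly" where "scalar a = [:[:a:]:]"

definition is_ideal :: "bipoly set \<Rightarrow> bool" where
  "is_ideal I \<longleftrightarrow> 0 \<in> I \<and> (\<forall>f\<in>I. \<forall>g\<in>I. f + g \<in> I) \<and> (\<forall>f\<in>I. \<forall>h. h * f \<in> I)"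

text \<open>
  \<open>is_coord I B f c\<close>: modulo \<open>I\<close>, the polynomial \<open>f\<close> is the linear combination of the elements of
  \<open>B\<close> with coefficients \<open>c\<close>. Thus \<open>quotient_basis I B\<close> says that \<open>B\<close> is finite and that the
  residue classes of its elements are pairwise distinct and form a \<open>\<complex>\<close>-basis of \<open>\<complex>[x,y]/I\<close>.
\<close>

definition is_coord :: "bipoly set \<Rightarrow> bipoly set \<Rightarrow> bipoly \<Rightarrow> (bipoly \<Rightarrow> complex) \<Rightarrow> bool" where
  "is_coord I B f c \<longleftrightarrow> (\<forall>b. b \<notin> B \<longrightarrow> c b = 0) \<and> f - (\<Sum>b\<in>B. scalar (c b) * b) \<in> I"

definition quotient_basis :: "bipoly set \<Rightarrow> bipoly set \<Rightarrow> bool" where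
  "quotient_basis I B \<longleftrightarrow> finite B \<and> (\<forall>f. \<exists>!c. is_coord I B f c)"

definition coord :: "bipoly set \<Rightarrow> bipoly set \<Rightarrow> bipoly \<Rightarrow> bipoly \<Rightarrow> complex" where
  "coord B I f = (THE c. is_coord I B f c)"

definition hilb_points :: "nat \<Rightarrow> bipoly set set" where
  "hilb_points n = {I. is_ideal I \<and> (\<exists>B. quotient_basis I B \<and> card B = n)}"


section \<open>The Zariski topology on the Hilbert scheme\<close>

text \<open>
  For a set \<open>B\<close> of \<open>n\<close> polynomials, the ideals \<open>I\<close> for which \<open>B\<close> induces a basis of
  \<open>\<complex>[x,y]/I\<close> are the closed points of an open affine subscheme of the Hilbert scheme of \<open>n\<close>
  points, and these subschemes cover it. Such an ideal is the kernel of the map sending \<open>f\<close> to its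
  coordinates with respect to \<open>B\<close>, and the conditions on these coordinates for the kernel to be an
  ideal are polynomial; hence the regular functions on the chart are generated, as a
  \<open>\<complex>\<close>-algebra, by the coordinates of all \<open>f\<close>. Only the space of closed points is considered; it
  determines the irreducible components and their dimensions.
\<close>

definition hilb_chart :: "bipoly set \<Rightarrow> bipoly set set" where
  "hilb_chart B = {I. is_ideal I \<and> quotient_basis I B}"

inductive_set chart_functions :: "bipoly set \<Rightarrow> (bipoly set \<Rightarrow> complex) set"
  for B :: "bipoly set" where
  const: "(\<lambda>I. a) \<in> chart_functions B"
| coord: "b \<in> B \<Longrightarrow> (\<lambda>I. coord B I f b) \<in> chart_functions B"
| add: "\<phi> \<in> chart_functions B \<Longrightarrow> \<psi> \<in> chart_functions B \<Longrightarrow>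
    (\<lambda>I. \<phi> I + \<psi> I) \<in> chart_functions B"
| mult: "\<phi> \<in> chart_functions B \<Longrightarrow> \<psi> \<in> chart_functions B \<Longrightarrow>
    (\<lambda>I. \<phi> I * \<psi> I) \<in> chart_functions B"

definition hilb :: "nat \<Rightarrow> bipoly set topology" where
  "hilb n = topology_generated_by
    {{I \<in> hilb_chart B. \<phi> I \<noteq> 0} | B \<phi>. finite B \<and> card B = n \<and> \<phi> \<in> chart_functions B}"


section \<open>The action of the special linear group\<close>

definition SL2 :: "(complex^2^2) monoid" where
  "SL2 = \<lparr>carrier = {A. det A = 1}, mult = (**), one = mat 1\<rparr>"

definition bipoly_subst :: "bipoly \<Rightarrow> bipoly \<Rightarrow> bipoly \<Rightarrow> bipoly" where
  "bipoly_subst u v f =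
    (\<Sum>i\<le>degree f. \<Sum>j\<le>degree (coeff f i). scalar (coeff (coeff f i) j) * u ^ i * v ^ j)"

text \<open>The polynomial function \<open>f\<close> is sent to \<open>f \<circ> A\<^sup>-\<^sup>1\<close>.\<close>

definition act_poly :: "complex^2^2 \<Rightarrow> bipoly \<Rightarrow> bipoly" where
  "act_poly A f = (let M = matrix_inv A in
    bipoly_subst (scalar (M $ 1 $ 1) * var_x + scalar (M $ 1 $ 2) * var_y)
                 (scalar (M $ 2 $ 1) * var_x + scalar (M $ 2 $ 2) * var_y) f)"

definition hilb_fixed_points :: "nat \<Rightarrow> (complex^2^2) set \<Rightarrow> bipoly set set" where
  "hilb_fixed_points n G = {I \<in> hilb_points n. \<forall>A\<in>G. act_poly A ` I = I}"

definition hilb_fixed :: "nat \<Rightarrow> (complex^2^2) set \<Rightarrow> bipoly set topology" where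
  "hilb_fixed n G = subtopology (hilb n) (hilb_fixed_points n G)"


section \<open>Irreducible components and dimension\<close>

definition irreducible_in :: "'a topology \<Rightarrow> 'a set \<Rightarrow> bool" where
  "irreducible_in X S \<longleftrightarrow> S \<subseteq> topspace X \<and> S \<noteq> {} \<and>
    (\<forall>C D. closedin X C \<and> closedin X D \<and> S \<subseteq> C \<union> D \<longrightarrow> S \<subseteq> C \<or> S \<subseteq> D)"

definition irreducible_component :: "'a topology \<Rightarrow> 'a set \<Rightarrow> bool" where
  "irreducible_component X Z \<longleftrightarrow>
    irreducible_in X Z \<and> (\<forall>S. irreducible_in X S \<and> Z \<subseteq> S \<longrightarrow> S = Z)"

text \<open>With values in \<^typ>\<open>enat\<close>, the empty space gets dimension \<open>0\<close>.\<close>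

definition krull_dim :: "'a topology \<Rightarrow> enat" where
  "krull_dim X = Sup {enat k | k. \<exists>Z :: nat \<Rightarrow> 'a set.
    (\<forall>i\<le>k. closedin X (Z i) \<and> irreducible_in X (Z i)) \<and> (\<forall>i<k. Z i \<subset> Z (Suc i))}"


section \<open>The binary polyhedral groups\<close>

text \<open>
  The special unitary group acts by conjugation on the traceless Hermitian matrices, identified
  with \<open>\<real>\<^sup>3\<close> through the Pauli matrices; this is the double cover of the rotation group. The binary
  group of a polyhedron with vertex set \<open>V\<close>, centred at the origin, is the preimage of the group
  of rotations that preserve \<open>V\<close>.
\<close>

definition adjoint_matrix :: "complex^2^2 \<Rightarrow> complex^2^2" where
  "adjoint_matrix A = (\<chi> i j. cnj (A $ j $ i))"

definition SU2 :: "(complex^2^2) set" where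
  "SU2 = {A. det A = 1 \<and> A ** adjoint_matrix A = mat 1}"

definition pauli :: "real^3 \<Rightarrow> complex^2^2" where
  "pauli v = vector [vector [complex_of_real (v $ 3), Complex (v $ 1) (- (v $ 2))],
                     vector [Complex (v $ 1) (v $ 2), - complex_of_real (v $ 3)]]"

definition binary_group :: "(real^3) set \<Rightarrow> (complex^2^2) set" where
  "binary_group V = {A \<in> SU2. (\<lambda>v. A ** pauli v ** adjoint_matrix A) ` V = pauli ` V}"

definition tetrahedron :: "(real^3) set" where
  "tetrahedron =
    {vector [1, 1, 1], vector [1, - 1, - 1], vector [- 1, 1, - 1], vector [- 1, - 1, 1]}"

definition octahedron :: "(real^3) set" where
  "octahedron = Basis \<union> uminus ` Basis"

definition icosahedron :: "(real^3) set" where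
  "icosahedron = (let \<phi> = (1 + sqrt 5) / 2 in
    \<Union>s\<in>{- 1, 1}. \<Union>t\<in>{- \<phi>, \<phi>}. {vector [0, s, t], vector [s, t, 0], vector [t, 0, s]})"

end

theory Submission
  imports Defs
begin

text \<open>
  An ideal of finite colength fixed by the special linear group is stable under the Lie algebra,
  hence spanned by monomials, hence a power \<open>m ^ d\<close> of the maximal ideal at the origin. The group
  \<open>\<Gamma>\<close> has even order, so it contains \<open>- 1\<close>, the only involution. In the chart where the
  monomials of degree less than \<open>d\<close> are a basis of the quotient, \<open>m ^ d\<close> is the only ideal fixed by
  \<open>- 1\<close>. Thus \<open>m ^ d\<close> is an isolated point already of the fixed locus of \<open>- 1\<close>.
\<close>

section \<open>Polynomials and monomials\<close>

text \<open>The obstacle is translation: for d > 0 the ideals m_p ^ d at nearby points p lie in the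
  same chart, so m ^ d is not isolated in the whole Hilbert scheme. They rewrite a monomial of
  degree d with terms of degree d - 1, and the sign by which - 1 acts on each degree forbids such
  terms. The isomorphism with a binary polyhedral group is only abstract: it transports an
  involution, not a matrix, and uniqueness of the involution in SL_2 turns it back into - 1. Finite
  colength excludes the zero ideal, the one other ideal stable under the Lie algebra.\<close>

abbreviation cf :: "bipoly \<Rightarrow> nat \<Rightarrow> nat \<Rightarrow> complex" where
  "cf f i j \<equiv> coeff (coeff f i) j"

definition mono_xy :: "nat \<Rightarrow> nat \<Rightarrow> bipoly" where
  "mono_xy i j = var_x ^ i * var_y ^ j"

lemma bipoly_eqI: "(\<And>i j. cf f i j = cf g i j) \<Longrightarrow> f = g"
  by (simp add: poly_eq_iff)

lemma scalar_mult_eq: "scalar a * f = smult [:a:] f"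
  by (simp add: scalar_def)

lemma cf_scalar_mult [simp]: "cf (scalar a * f) i j = a * cf f i j"
  by (simp add: scalar_mult_eq)

lemma scalar_0 [simp]: "scalar 0 = 0" and scalar_1 [simp]: "scalar 1 = 1"
  by (simp_all add: scalar_def one_pCons)

lemma scalar_add: "scalar (a + b) = scalar a + scalar b"
  and scalar_diff: "scalar (a - b) = scalar a - scalar b"
  and scalar_minus: "scalar (- a) = - scalar a"
  and scalar_mult: "scalar (a * b) = scalar a * scalar b"
  by (simp_all add: scalar_def)

lemma scalar_power: "scalar (a ^ k) = scalar a ^ k"
  by (induction k) (simp_all add: scalar_mult)

lemma mono_xy_eq_monom: "mono_xy i j = monom (monom 1 j) i"
proof -
  have x: "var_x ^ i = monom 1 i"
    by (simp add: var_x_def monom_altdef)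
  have y: "var_y ^ j = [:monom 1 j:]"
  proof (induction j)
    case (Suc j)
    then show ?case by (simp add: var_y_def monom_Suc)
  qed (simp add: one_pCons)
  show ?thesis
    unfolding mono_xy_def x y by (simp add: mult.commute smult_monom)
qed

lemma cf_mono_xy [simp]: "cf (mono_xy a b) i j = (if a = i \<and> b = j then 1 else 0)"
  by (simp add: mono_xy_eq_monom)

lemma mono_xy_eq_iff [simp]: "mono_xy a b = mono_xy i j \<longleftrightarrow> a = i \<and> b = j"
  by (metis cf_mono_xy zero_neq_one)

lemma mult_mono_xy: "mono_xy a b * mono_xy i j = mono_xy (a + i) (b + j)"
  by (simp add: mono_xy_def power_add mult_ac)

lemma cf_sum: "cf (\<Sum>a\<in>A. g a) i j = (\<Sum>a\<in>A. cf (g a) i j)"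
  by (simp add: coeff_sum)

lemma cf_combination:
  assumes "finite S"
  shows "cf (\<Sum>(a, b)\<in>S. scalar (c a b) * mono_xy a b) i j = (if (i, j) \<in> S then c i j else 0)"
proof -
  have "cf (\<Sum>(a, b)\<in>S. scalar (c a b) * mono_xy a b) i j =
      (\<Sum>p\<in>S. if p = (i, j) then c i j else 0)"
    unfolding cf_sum by (rule sum.cong) (auto split: prod.splits)
  also have "\<dots> = (if (i, j) \<in> S then c i j else 0)"
    using assms by simp
  finally show ?thesis .
qed

text \<open>Chosen as the index range of the double sum in \<open>bipoly_subst\<close>. It contains
  the support of \<open>f\<close>, may be larger, and always contains (0, 0).\<close>

definition box :: "bipoly \<Rightarrow> (nat \<times> nat) set" where
  "box f = (SIGMA i:{..degree f}. {..degree (coeff f i)})"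

lemma finite_box [simp]: "finite (box f)"
  by (simp add: box_def)

lemma cf_nonzero_imp_box: "cf f i j \<noteq> 0 \<Longrightarrow> (i, j) \<in> box f"
  by (auto simp: box_def intro!: le_degree)

lemma bipoly_subst_box:
  "bipoly_subst u v f = (\<Sum>(i, j)\<in>box f. scalar (cf f i j) * u ^ i * v ^ j)"
  by (simp add: bipoly_subst_def box_def sum.Sigma)

lemma bipoly_expand: "f = (\<Sum>(i, j)\<in>box f. scalar (cf f i j) * mono_xy i j)"
proof (rule bipoly_eqI)
  fix i j
  show "cf f i j = cf (\<Sum>(i, j)\<in>box f. scalar (cf f i j) * mono_xy i j) i j"
    unfolding cf_combination[OF finite_box] using cf_nonzero_imp_box by auto
qed

lemma cf_subst_minus [simp]:
  "cf (bipoly_subst (- var_x) (- var_y) f) i j = (- 1) ^ (i + j) * cf f i j"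
proof -
  have "scalar (cf f i j) * (- var_x) ^ i * (- var_y) ^ j =
      scalar ((- 1) ^ (i + j) * cf f i j) * mono_xy i j" for i j
    by (simp add: mono_xy_def power_add power_minus[of var_x] power_minus[of var_y]
        scalar_mult scalar_power scalar_minus mult_ac)
  then have "bipoly_subst (- var_x) (- var_y) f =
      (\<Sum>(i, j)\<in>box f. scalar ((- 1) ^ (i + j) * cf f i j) * mono_xy i j)"
    by (simp add: bipoly_subst_box)
  then show ?thesis
    using cf_nonzero_imp_box[of f i j]
    by (auto simp: cf_combination)
qed


section \<open>Ideals\<close>

lemma ideal_zero: "is_ideal I \<Longrightarrow> 0 \<in> I"
  and ideal_add: "is_ideal I \<Longrightarrow> f \<in> I \<Longrightarrow> g \<in> I \<Longrightarrow> f + g \<in> I"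
  and ideal_mult: "is_ideal I \<Longrightarrow> f \<in> I \<Longrightarrow> h * f \<in> I"
  by (simp_all add: is_ideal_def)

lemma ideal_diff:
  assumes "is_ideal I" "f \<in> I" "g \<in> I"
  shows "f - g \<in> I"
  using ideal_add[OF assms(1,2) ideal_mult[OF assms(1,3), of "- 1"]] by simp

lemma ideal_sum: "is_ideal I \<Longrightarrow> (\<And>a. a \<in> A \<Longrightarrow> g a \<in> I) \<Longrightarrow> (\<Sum>a\<in>A. g a) \<in> I"
  by (induction A rule: infinite_finite_induct) (auto intro: ideal_zero ideal_add)

lemma ideal_scalar_cancel:
  assumes "is_ideal I" "scalar a * f \<in> I" "a \<noteq> 0"
  shows "f \<in> I"
proof -
  have "f = scalar (inverse a * a) * f"
    using assms(3) by simp
  also have "\<dots> = scalar (inverse a) * (scalar a * f)"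
    by (simp only: scalar_mult mult.assoc)
  also have "\<dots> \<in> I"
    by (rule ideal_mult[OF assms(1,2)])
  finally show ?thesis .
qed

text \<open>Subtracting \<open>r j\<close> times the m-th sum from the next one kills
  \<open>v j\<close> and multiplies each other \<open>v i\<close> by \<open>r i - r j\<close>, which
  is nonzero; this is induction on the number of nodes, with the vectors rescaled. It serves twice:
  for coefficients of one-parameter groups and for eigenvectors.\<close>

lemma ideal_vandermonde:
  assumes "is_ideal I" "finite S" "inj_on r S"
    and "\<And>m. (\<Sum>i\<in>S. scalar (r i ^ m) * v i) \<in> I" "i \<in> S"
  shows "v i \<in> I"
  using assms(2-)
proof (induction S arbitrary: v i rule: finite_induct)
  case (insert j S)
  have rest: "v i \<in> I" if "i \<in> S" for i
  proof -
    have "(\<Sum>i\<in>S. scalar (r i ^ m) * (scalar (r i - r j) * v i)) \<in> I" for m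
    proof -
      let ?P = "\<lambda>m. \<Sum>i\<in>insert j S. scalar (r i ^ m) * v i"
      have "?P (Suc m) - scalar (r j) * ?P m =
          (\<Sum>i\<in>insert j S. scalar (r i ^ m) * (scalar (r i - r j) * v i))"
        unfolding sum_distrib_left sum_subtractf[symmetric]
        by (rule sum.cong) (simp_all add: scalar_mult scalar_diff algebra_simps)
      also have "\<dots> = (\<Sum>i\<in>S. scalar (r i ^ m) * (scalar (r i - r j) * v i))"
        using insert.hyps by simp
      finally show ?thesis
        using ideal_diff[OF assms(1) insert.prems(2)[of "Suc m"]
            ideal_mult[OF assms(1) insert.prems(2)[of m], of "scalar (r j)"]]
        by simp
    qed
    then have "scalar (r i - r j) * v i \<in> I"
      using insert.IH[of "\<lambda>i. scalar (r i - r j) * v i" i] insert.prems(1) that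
      by simp
    moreover have "r i - r j \<noteq> 0"
      using insert.hyps insert.prems(1) that by (metis inj_onD insertCI eq_iff_diff_eq_0)
    ultimately show ?thesis
      using ideal_scalar_cancel[OF assms(1)] by blast
  qed
  \<comment> \<open>All weights are 1 for exponent 0, so removing the terms already known to lie in
    \<open>I\<close> leaves \<open>v j\<close>.\<close>
  have "(\<Sum>i\<in>insert j S. v i) \<in> I"
    using insert.prems(2)[of 0] by simp
  from ideal_diff[OF assms(1) this ideal_sum[OF assms(1) rest]]
  have "(\<Sum>i\<in>insert j S. v i) - (\<Sum>i\<in>S. v i) \<in> I" .
  then show ?case
    using insert rest by auto
qed simp

text \<open>The power m ^ d for m = (x, y), described by coefficients; \<open>d = 0\<close> gives
  the whole ring, the only ideal of colength 0.\<close>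

definition max_ideal_power :: "nat \<Rightarrow> bipoly set" where
  "max_ideal_power d = {f. \<forall>i j. i + j < d \<longrightarrow> cf f i j = 0}"

lemma max_ideal_power_subset:
  assumes I: "is_ideal I" and mono: "\<And>i j. i + j = d \<Longrightarrow> mono_xy i j \<in> I"
  shows "max_ideal_power d \<subseteq> I"
proof
  have mono': "mono_xy i j \<in> I" if "d \<le> i + j" for i j
  proof -
    \<comment> \<open>The factor of degree exactly \<open>d\<close> that takes as many x as possible
      still divides the monomial, because \<open>d \<le> i + j\<close>.\<close>
    define a where "a = min i d"
    have "mono_xy (i - a) (j - (d - a)) * mono_xy a (d - a) = mono_xy i j"
      using that by (simp add: mult_mono_xy a_def min_def)
    moreover have "mono_xy a (d - a) \<in> I"
      by (rule mono) (simp add: a_def)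
    ultimately show ?thesis
      using ideal_mult[OF I] by metis
  qed
  fix f assume f: "f \<in> max_ideal_power d"
  have "scalar (cf f i j) * mono_xy i j \<in> I" for i j
  proof (cases "i + j < d")
    case True
    then show ?thesis using f ideal_zero[OF I] by (simp add: max_ideal_power_def)
  qed (use mono' ideal_mult[OF I] in auto)
  then have "(\<Sum>(i, j)\<in>box f. scalar (cf f i j) * mono_xy i j) \<in> I"
    by (intro ideal_sum[OF I]) auto
  then show "f \<in> I"
    using bipoly_expand[of f] by simp
qed


section \<open>Ideals fixed by the special linear group\<close>

text \<open>The vector field y d/dx; its companion \<open>raise\<close> is x d/dy, since
  \<open>map_poly pderiv\<close> differentiates the inner variable. They are the nilpotent
  generators of sl_2.\<close>

definition lower :: "bipoly \<Rightarrow> bipoly" where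
  "lower f = var_y * pderiv f"

definition raise :: "bipoly \<Rightarrow> bipoly" where
  "raise f = var_x * map_poly pderiv f"

lemma lower_linear: "lower (f + g) = lower f + lower g" "lower (scalar a * f) = scalar a * lower f"
  by (simp_all add: lower_def pderiv_add distrib_left scalar_mult_eq pderiv_smult)

lemma raise_linear: "raise (f + g) = raise f + raise g" "raise (scalar a * f) = scalar a * raise f"
proof -
  have "map_poly pderiv (f + g) = map_poly pderiv f + map_poly pderiv g"
    by (rule poly_eqI) (simp add: coeff_map_poly pderiv_add)
  then show "raise (f + g) = raise f + raise g"
    by (simp add: raise_def distrib_left)
  have "map_poly pderiv (scalar a * f) = scalar a * map_poly pderiv f"
    by (rule poly_eqI) (simp add: coeff_map_poly scalar_mult_eq pderiv_smult)
  then show "raise (scalar a * f) = scalar a * raise f"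
    by (simp add: raise_def mult.left_commute)
qed

lemma scalar_of_nat: "scalar (of_nat n) = of_nat n"
  by (induction n) (simp_all add: scalar_add)

lemma lower_mono_xy: "lower (mono_xy i j) = scalar (of_nat i) * mono_xy (i - 1) (Suc j)"
proof -
  have "pderiv (mono_xy i j) = scalar (of_nat i) * mono_xy (i - 1) j"
    by (rule bipoly_eqI) (simp add: mono_xy_eq_monom pderiv_monom scalar_mult_eq smult_monom of_nat_poly)
  then show ?thesis
    by (simp add: lower_def mono_xy_def mult_ac)
qed

lemma raise_mono_xy: "raise (mono_xy i j) = scalar (of_nat j) * mono_xy (Suc i) (j - 1)"
proof -
  have "map_poly pderiv (mono_xy i j) = scalar (of_nat j) * mono_xy i (j - 1)"
    by (rule bipoly_eqI)
      (auto simp: mono_xy_eq_monom coeff_map_poly pderiv_monom scalar_mult_eq smult_monom)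
  then show ?thesis
    by (simp add: raise_def mono_xy_def mult_ac)
qed

lemma linear_sum_scalar:
  assumes "\<And>f g. T (f + g) = T f + T g" "\<And>a f. T (scalar a * f) = scalar a * T f"
  shows "T (\<Sum>(i, j)\<in>S. scalar (c i j) * g i j) = (\<Sum>(i, j)\<in>S. scalar (c i j) * T (g i j))"
proof -
  have zero: "T 0 = 0"
    using assms(2)[of 0 0] by simp
  show ?thesis
    by (induction S rule: infinite_finite_induct) (auto simp: assms zero)
qed

text \<open>
  A unipotent one-parameter group acts by polynomials in the parameter; applying the Vandermonde
  argument to the parameters \<open>2 ^ m\<close> extracts the linear coefficient, the Lie algebra action.
\<close>

lemma ideal_unipotent:
  assumes I: "is_ideal I"
    and expand: "\<And>s i j. u s ^ i * v s ^ j = (\<Sum>k\<le>i + j. scalar (s ^ k) * w i j k)"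
    and subst: "\<And>s. bipoly_subst (u s) (v s) f \<in> I"
    and w0: "w 0 0 1 = 0"
  shows "(\<Sum>(i, j)\<in>box f. scalar (cf f i j) * w i j 1) \<in> I"
proof -
  \<comment> \<open>A common bound for all the expansions; \<open>Suc\<close> keeps the wanted index
    1 in range even for constant \<open>f\<close>.\<close>
  define N where "N = Suc (\<Sum>(i, j)\<in>box f. i + j)"
  \<comment> \<open>Padding with zeros lets every inner sum run up to \<open>N\<close>, so that the
    sums can be swapped. At \<open>k = 1\<close> the padding alters only the index (0, 0), which
    \<open>w0\<close> covers.\<close>
  define w' where "w' i j k = (if k \<le> i + j then w i j k else 0)" for i j k
  define V where "V k = (\<Sum>(i, j)\<in>box f. scalar (cf f i j) * w' i j k)" for k
  have le: "i + j \<le> N" if "(i, j) \<in> box f" for i j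
    using member_le_sum[OF that, of "\<lambda>(i, j). i + j"] by (simp add: N_def)
  have "bipoly_subst (u s) (v s) f = (\<Sum>k\<le>N. scalar (s ^ k) * V k)" for s
  proof -
    have "scalar (cf f i j) * u s ^ i * v s ^ j =
        (\<Sum>k\<le>N. scalar (s ^ k) * (scalar (cf f i j) * w' i j k))"
      if "(i, j) \<in> box f" for i j
    proof -
      have "scalar (cf f i j) * u s ^ i * v s ^ j =
          (\<Sum>k\<le>i + j. scalar (s ^ k) * (scalar (cf f i j) * w' i j k))"
        unfolding mult.assoc expand sum_distrib_left
        by (rule sum.cong) (simp_all add: w'_def mult_ac)
      also have "\<dots> = (\<Sum>k\<le>N. scalar (s ^ k) * (scalar (cf f i j) * w' i j k))"
        using le[OF that] by (intro sum.mono_neutral_left) (auto simp: w'_def)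
      finally show ?thesis .
    qed
    then have "bipoly_subst (u s) (v s) f =
        (\<Sum>(i, j)\<in>box f. \<Sum>k\<le>N. scalar (s ^ k) * (scalar (cf f i j) * w' i j k))"
      unfolding bipoly_subst_box by (intro sum.cong) auto
    also have "\<dots> = (\<Sum>k\<le>N. \<Sum>(i, j)\<in>box f. scalar (s ^ k) * (scalar (cf f i j) * w' i j k))"
      unfolding case_prod_unfold by (rule sum.swap)
    also have "\<dots> = (\<Sum>k\<le>N. scalar (s ^ k) * V k)"
      by (simp add: V_def sum_distrib_left case_prod_unfold)
    finally show ?thesis .
  qed
  then have *: "(\<Sum>k\<le>N. scalar (s ^ k) * V k) \<in> I" for s
    using subst by simp
  have "V 1 \<in> I"
  proof (rule ideal_vandermonde[OF I, where v = V and r = "\<lambda>k. 2 ^ k"])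
    show "finite {..N}" by simp
    show "inj_on (\<lambda>k. (2 :: complex) ^ k) {..N}"
    proof (rule inj_onI)
      fix k l :: nat
      assume "(2 :: complex) ^ k = 2 ^ l"
      then have "of_nat (2 ^ k) = (of_nat (2 ^ l) :: complex)" by simp
      then have "(2 :: nat) ^ k = 2 ^ l" by (simp only: of_nat_eq_iff)
      then show "k = l" by simp
    qed
    \<comment> \<open>Exchanging exponents turns the m-th power of the nodes into the single
      parameter \<open>2 ^ m\<close>.\<close>
    show "(\<Sum>k\<le>N. scalar ((2 ^ k) ^ m) * V k) \<in> I" for m
      using *[of "2 ^ m"] by (simp only: power_mult[symmetric] mult.commute)
    show "1 \<in> {..N}" by (simp add: N_def)
  qed
  moreover have "w' i j 1 = w i j 1" for i j
    using w0 by (cases "i + j = 0") (auto simp: w'_def)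
  ultimately show ?thesis
    by (simp add: V_def)
qed

text \<open>In the binomial expansion of (x + s y)^i y^j the coefficient of s is i x^(i-1) y^(j+1),
  the image of x^i y^j under y d/dx.\<close>

lemma ideal_lower:
  assumes I: "is_ideal I" and subst: "\<And>s. bipoly_subst (var_x + scalar s * var_y) var_y f \<in> I"
  shows "lower f \<in> I"
proof -
  \<comment> \<open>For \<open>k > i\<close> the truncated exponent \<open>i - k\<close> is
    harmless, as the binomial coefficient vanishes.\<close>
  define w where "w i j k = scalar (of_nat (i choose k)) * mono_xy (i - k) (j + k)" for i j k
  have "(var_x + scalar s * var_y) ^ i * var_y ^ j = (\<Sum>k\<le>i + j. scalar (s ^ k) * w i j k)" for s i j
  proof -
    have "(var_x + scalar s * var_y) ^ i * var_y ^ j = (\<Sum>k\<le>i. scalar (s ^ k) * w i j k)"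
      unfolding add.commute[of var_x] binomial_ring sum_distrib_right
      by (rule sum.cong) (simp_all add: w_def mono_xy_def scalar_of_nat scalar_power power_mult_distrib power_add mult_ac)
    also have "\<dots> = (\<Sum>k\<le>i + j. scalar (s ^ k) * w i j k)"
      by (rule sum.mono_neutral_left) (auto simp: w_def binomial_eq_0)
    finally show ?thesis .
  qed
  from ideal_unipotent[OF I this subst]
  have "(\<Sum>(i, j)\<in>box f. scalar (cf f i j) * w i j 1) \<in> I"
    by (simp add: w_def)
  also have "(\<Sum>(i, j)\<in>box f. scalar (cf f i j) * w i j 1) =
      (\<Sum>(i, j)\<in>box f. scalar (cf f i j) * lower (mono_xy i j))"
    by (simp add: w_def lower_mono_xy)
  also have "\<dots> = lower f"
    using linear_sum_scalar[of lower, OF lower_linear] bipoly_expand[of f] by metis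
  finally show ?thesis .
qed

lemma ideal_raise:
  assumes I: "is_ideal I" and subst: "\<And>s. bipoly_subst var_x (var_y + scalar s * var_x) f \<in> I"
  shows "raise f \<in> I"
proof -
  define w where "w i j k = scalar (of_nat (j choose k)) * mono_xy (i + k) (j - k)" for i j k
  have "var_x ^ i * (var_y + scalar s * var_x) ^ j = (\<Sum>k\<le>i + j. scalar (s ^ k) * w i j k)" for s i j
  proof -
    have "var_x ^ i * (var_y + scalar s * var_x) ^ j = (\<Sum>k\<le>j. scalar (s ^ k) * w i j k)"
      unfolding add.commute[of var_y] binomial_ring sum_distrib_left
      by (rule sum.cong) (simp_all add: w_def mono_xy_def scalar_of_nat scalar_power power_mult_distrib power_add mult_ac)
    also have "\<dots> = (\<Sum>k\<le>i + j. scalar (s ^ k) * w i j k)"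
      by (rule sum.mono_neutral_left) (auto simp: w_def binomial_eq_0)
    finally show ?thesis .
  qed
  from ideal_unipotent[OF I this subst]
  have "(\<Sum>(i, j)\<in>box f. scalar (cf f i j) * w i j 1) \<in> I"
    by (simp add: w_def)
  also have "(\<Sum>(i, j)\<in>box f. scalar (cf f i j) * w i j 1) =
      (\<Sum>(i, j)\<in>box f. scalar (cf f i j) * raise (mono_xy i j))"
    by (simp add: w_def raise_mono_xy)
  also have "\<dots> = raise f"
    using linear_sum_scalar[of raise, OF raise_linear] bipoly_expand[of f] by metis
  finally show ?thesis .
qed

text \<open>On x^i y^j, \<open>lower \<circ> raise\<close> has eigenvalue j(i+1) and
  \<open>raise \<circ> lower\<close> has i(j+1). Packing both integers into one complex number lets
  a single operator do the work of two.\<close>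

definition mono_eigenvalue :: "nat \<Rightarrow> nat \<Rightarrow> complex" where
  "mono_eigenvalue i j = Complex (of_nat (j * Suc i)) (of_nat (i * Suc j))"

text \<open>The two parts differ by j - i, so the weight is determined; for fixed weight i and j
  grow together, and then i(j+1) is strictly increasing.\<close>

lemma mono_eigenvalue_inj:
  assumes "mono_eigenvalue i j = mono_eigenvalue k l"
  shows "i = k \<and> j = l"
proof -
  have 1: "j * Suc i = l * Suc k" and 2: "i * Suc j = k * Suc l"
    using assms unfolding mono_eigenvalue_def complex.inject of_nat_eq_iff by auto
  then have diff: "i + l = k + j"
    by (simp add: mult.commute)
  consider "i < k" | "k < i" | "i = k" by linarith
  then show ?thesis
  proof cases
    case 1
    then have "j < l" using diff by simp
    with 1 have "i * Suc j < k * Suc l" by (intro mult_less_le_imp_less) auto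
    then show ?thesis using 2 by simp
  next
    case 2
    then have "l < j" using diff by simp
    with 2 have "k * Suc l < i * Suc j" by (intro mult_less_le_imp_less) auto
    then show ?thesis using \<open>i * Suc j = k * Suc l\<close> by simp
  qed (use diff in simp)
qed

text \<open>The eigenvalues of \<open>T = lower \<circ> raise + \<i> * raise \<circ> lower\<close> separate the monomials.\<close>

lemma ideal_contains_monomials:
  assumes I: "is_ideal I" and lower: "\<And>f. f \<in> I \<Longrightarrow> lower f \<in> I"
    and raise: "\<And>f. f \<in> I \<Longrightarrow> raise f \<in> I" and f: "f \<in> I" "cf f i j \<noteq> 0"
  shows "mono_xy i j \<in> I"
proof -
  define T where "T g = lower (raise g) + scalar \<i> * raise (lower g)" for g
  have T: "T (g + h) = T g + T h" "T (scalar a * g) = scalar a * T g" for g h a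
    by (simp_all add: T_def lower_linear raise_linear distrib_left mult.left_commute)
  have T_mono: "T (mono_xy i j) = scalar (mono_eigenvalue i j) * mono_xy i j" for i j
  proof -
    have lr: "lower (raise (mono_xy i j)) = scalar (of_nat (j * Suc i)) * mono_xy i j"
      unfolding raise_mono_xy lower_linear lower_mono_xy of_nat_mult scalar_mult mult.assoc
      by (cases j) simp_all
    have rl: "raise (lower (mono_xy i j)) = scalar (of_nat (i * Suc j)) * mono_xy i j"
      unfolding lower_mono_xy raise_linear raise_mono_xy of_nat_mult scalar_mult mult.assoc
      by (cases i) simp_all
    have "mono_eigenvalue i j = of_nat (j * Suc i) + \<i> * of_nat (i * Suc j)"
      by (simp add: mono_eigenvalue_def complex_eq_iff)
    then show ?thesis
      unfolding T_def lr rl by (simp only: scalar_add scalar_mult distrib_right mult.assoc)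
  qed
  have T_I: "T g \<in> I" if "g \<in> I" for g
    using that by (simp add: T_def I lower raise ideal_add ideal_mult)
  let ?S = "\<lambda>m. \<Sum>(i, j)\<in>box f. scalar (mono_eigenvalue i j ^ m * cf f i j) * mono_xy i j"
  have "?S m \<in> I" for m
  proof (induction m)
    case 0
    then show ?case using f bipoly_expand[of f] by simp
  next
    case (Suc m)
    have "T (?S m) = ?S (Suc m)"
      unfolding linear_sum_scalar[of T, OF T]
      by (rule sum.cong) (auto simp: T_mono scalar_mult mult_ac)
    then show ?case using T_I[OF Suc] by simp
  qed
  then have sums: "(\<Sum>p\<in>box f. scalar ((case_prod mono_eigenvalue p) ^ m) *
      (scalar (case_prod (cf f) p) * case_prod mono_xy p)) \<in> I" for m
    by (simp add: case_prod_unfold scalar_mult mult.assoc)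
  have "inj_on (case_prod mono_eigenvalue) (box f)"
    using mono_eigenvalue_inj by (auto simp: inj_on_def)
  from ideal_vandermonde[OF I finite_box this sums cf_nonzero_imp_box[OF f(2)]]
  have "scalar (cf f i j) * mono_xy i j \<in> I"
    by simp
  then show ?thesis
    using ideal_scalar_cancel[OF I] f(2) by blast
qed

text \<open>The forms of a given degree are an irreducible sl_2-module: \<open>raise\<close> and
  \<open>lower\<close> connect its monomials with nonzero integer factors. So \<open>I\<close>
  contains all monomials of a degree or none, and \<open>d\<close> is the least degree that
  occurs.\<close>

lemma eq_max_ideal_power:
  assumes I: "is_ideal I" and lower: "\<And>f. f \<in> I \<Longrightarrow> lower f \<in> I"
    and raise: "\<And>f. f \<in> I \<Longrightarrow> raise f \<in> I" and nz: "I \<noteq> {0}"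
  obtains d where "I = max_ideal_power d"
proof -
  have mono: "mono_xy i j \<in> I" if "f \<in> I" "cf f i j \<noteq> 0" for f i j
    by (rule ideal_contains_monomials[OF I _ _ that]) (simp_all add: lower raise)
  have up: "mono_xy (i + j) 0 \<in> I" if "mono_xy i j \<in> I" for i j
    using that
  proof (induction j arbitrary: i)
    case (Suc j)
    have "mono_xy (Suc i) j \<in> I"
      using raise[OF Suc.prems] unfolding raise_mono_xy diff_Suc_1
      by (rule ideal_scalar_cancel[OF I, of "of_nat (Suc j)"]) (simp_all del: of_nat_Suc)
    from Suc.IH[OF this] show ?case by simp
  qed simp
  have down: "mono_xy i j \<in> I" if "mono_xy (i + j) 0 \<in> I" for i j
    using that
  proof (induction j arbitrary: i)
    case (Suc j)
    then have "mono_xy (Suc i) j \<in> I" by simp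
    from lower[OF this] show ?case
      unfolding lower_mono_xy diff_Suc_1
      by (rule ideal_scalar_cancel[OF I, of "of_nat (Suc i)"]) (simp_all del: of_nat_Suc)
  qed simp
  obtain f where "f \<in> I" "f \<noteq> 0"
    using nz ideal_zero[OF I] by blast
  then obtain i j where "cf f i j \<noteq> 0"
    using bipoly_eqI[of f 0] by auto
  then have ex: "\<exists>d i j. i + j = d \<and> mono_xy i j \<in> I"
    using mono[OF \<open>f \<in> I\<close>] by blast
  define d where "d = (LEAST d. \<exists>i j. i + j = d \<and> mono_xy i j \<in> I)"
  have "\<exists>i j. i + j = d \<and> mono_xy i j \<in> I"
    unfolding d_def using ex by (rule LeastI_ex)
  then have "mono_xy d 0 \<in> I"
    using up by blast
  then have "max_ideal_power d \<subseteq> I"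
    using down by (intro max_ideal_power_subset[OF I]) blast
  moreover have "I \<subseteq> max_ideal_power d"
  proof
    fix f assume "f \<in> I"
    have "d \<le> i + j" if "cf f i j \<noteq> 0" for i j
      unfolding d_def using mono[OF \<open>f \<in> I\<close> that] by (intro Least_le) blast
    then show "f \<in> max_ideal_power d"
      unfolding max_ideal_power_def using not_le by blast
  qed
  ultimately show ?thesis
    by (intro that subset_antisym)
qed

section \<open>Explicit matrices acting by substitution\<close>

lemma matrix_inv_eqI:
  fixes A B :: "complex^'n^'n"
  assumes "A ** B = mat 1"
  shows "matrix_inv A = B"
proof -
  have BA: "B ** A = mat 1"
    using assms matrix_left_right_inverse by blast
  have "A ** matrix_inv A = mat 1 \<and> matrix_inv A ** A = mat 1"
    unfolding matrix_inv_def by (rule someI[of _ B]) (use assms BA in simp)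
  then show ?thesis
    by (metis assms matrix_mul_assoc matrix_mul_lid matrix_mul_rid)
qed

text \<open>The sign of \<open>- s\<close> compensates for the inverse matrix in
  \<open>act_poly\<close>.\<close>

lemma act_poly_unipotent:
  "act_poly (vector [vector [1, - s], vector [0, 1]]) f = bipoly_subst (var_x + scalar s * var_y) var_y f"
  "act_poly (vector [vector [1, 0], vector [- s, 1]]) f = bipoly_subst var_x (var_y + scalar s * var_x) f"
proof -
  have "matrix_inv (vector [vector [1, - s], vector [0, 1]]) =
      (vector [vector [1, s], vector [0, 1]] :: complex^2^2)"
    by (rule matrix_inv_eqI) (simp add: vec_eq_iff forall_2 matrix_matrix_mult_def sum_2 mat_def)
  then show "act_poly (vector [vector [1, - s], vector [0, 1]]) f =
      bipoly_subst (var_x + scalar s * var_y) var_y f"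
    by (simp add: act_poly_def)
  have "matrix_inv (vector [vector [1, 0], vector [- s, 1]]) =
      (vector [vector [1, 0], vector [s, 1]] :: complex^2^2)"
    by (rule matrix_inv_eqI) (simp add: vec_eq_iff forall_2 matrix_matrix_mult_def sum_2 mat_def)
  then show "act_poly (vector [vector [1, 0], vector [- s, 1]]) f =
      bipoly_subst var_x (var_y + scalar s * var_x) f"
    by (simp add: act_poly_def add.commute)
qed

lemma act_poly_minus_one: "act_poly (- mat 1) f = bipoly_subst (- var_x) (- var_y) f"
proof -
  have "matrix_inv (- mat 1) = (- mat 1 :: complex^2^2)"
    by (rule matrix_inv_eqI) (simp add: vec_eq_iff forall_2 matrix_matrix_mult_def sum_2 mat_def)
  then show ?thesis
    by (simp add: act_poly_def mat_def scalar_minus)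
qed

text \<open>A power of x beyond the x-degrees of all elements of \<open>B\<close> is not a
  combination of them.\<close>

lemma quotient_basis_zero_ideal: "\<not> quotient_basis {0} B"
proof
  assume B: "quotient_basis {0} B"
  then have fin: "finite B" by (simp add: quotient_basis_def)
  define N where "N = Suc (\<Sum>b\<in>B. degree b)"
  obtain c where "is_coord {0} B (mono_xy N 0) c"
    using B unfolding quotient_basis_def by blast
  then have eq: "mono_xy N 0 = (\<Sum>b\<in>B. scalar (c b) * b)"
    by (simp add: is_coord_def)
  have "cf (mono_xy N 0) N 0 = (\<Sum>b\<in>B. c b * cf b N 0)"
    by (subst eq) (simp add: cf_sum)
  also have "\<dots> = 0"
  proof (rule sum.neutral, rule ballI)
    fix b assume "b \<in> B"
    then have "degree b < N"
      using member_le_sum[of b B degree] fin by (simp add: N_def)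
    then show "c b * cf b N 0 = 0" by (simp add: coeff_eq_0)
  qed
  finally show False by simp
qed

lemma SL2_fixed_eq_max_ideal_power:
  assumes "I \<in> hilb_fixed_points n (carrier SL2)"
  obtains d where "I = max_ideal_power d"
proof -
  have I: "is_ideal I" and B: "\<exists>B. quotient_basis I B"
    and fixed: "\<And>A. det A = 1 \<Longrightarrow> act_poly A ` I = I"
    using assms by (auto simp: hilb_fixed_points_def hilb_points_def SL2_def)
  have "I \<noteq> {0}"
    using B quotient_basis_zero_ideal by blast
  moreover have "lower f \<in> I" if "f \<in> I" for f
  proof (rule ideal_lower[OF I])
    fix s
    show "bipoly_subst (var_x + scalar s * var_y) var_y f \<in> I"
      using fixed[of "vector [vector [1, - s], vector [0, 1]]"] that
      by (auto simp: det_2 act_poly_unipotent)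
  qed
  moreover have "raise f \<in> I" if "f \<in> I" for f
  proof (rule ideal_raise[OF I])
    fix s
    show "bipoly_subst var_x (var_y + scalar s * var_x) f \<in> I"
      using fixed[of "vector [vector [1, 0], vector [- s, 1]]"] that
      by (auto simp: det_2 act_poly_unipotent)
  qed
  ultimately show ?thesis
    using eq_max_ideal_power[OF I] that by metis
qed

section \<open>The chart of the monomials of low degree\<close>

definition low_monos :: "nat \<Rightarrow> bipoly set" where
  "low_monos d = (\<lambda>(i, j). mono_xy i j) ` {(i, j). i + j < d}"

lemma finite_low_index: "finite {(i, j). i + j < (d :: nat)}"
  by (rule finite_subset[of _ "{..d} \<times> {..d}"]) auto

lemma finite_low_monos: "finite (low_monos d)"
  unfolding low_monos_def by (intro finite_imageI finite_low_index)

lemma cf_low_combination: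
  "cf (\<Sum>b\<in>low_monos d. scalar (c b) * b) i j = (if i + j < d then c (mono_xy i j) else 0)"
proof -
  have "(\<Sum>b\<in>low_monos d. scalar (c b) * b) =
      (\<Sum>(i, j)\<in>{(i, j). i + j < d}. scalar (c (mono_xy i j)) * mono_xy i j)"
    unfolding low_monos_def
    by (subst sum.reindex) (auto simp: inj_on_def case_prod_unfold)
  then show ?thesis
    by (simp add: cf_combination[OF finite_low_index])
qed

lemma low_coefficients_exist:
  obtains c where "\<And>b. b \<notin> low_monos d \<Longrightarrow> c b = 0"
    and "\<And>i j. i + j < d \<Longrightarrow> c (mono_xy i j) = cf f i j"
proof -
  \<comment> \<open>Coordinates are indexed by polynomials, not exponents. As \<open>mono_xy\<close>
    is injective, at most one term survives, which avoids choosing an inverse.\<close>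
  define c where "c b = (\<Sum>(i, j)\<in>{(i, j). i + j < d}. if b = mono_xy i j then cf f i j else 0)" for b
  have "c b = 0" if "b \<notin> low_monos d" for b
    unfolding c_def using that by (intro sum.neutral) (auto simp: low_monos_def)
  moreover have "c (mono_xy i j) = cf f i j" if "i + j < d" for i j
  proof -
    have "c (mono_xy i j) = (\<Sum>p\<in>{(i, j). i + j < d}. if p = (i, j) then cf f i j else 0)"
      unfolding c_def by (rule sum.cong) (auto split: if_splits)
    then show ?thesis
      using that finite_low_index by simp
  qed
  ultimately show ?thesis using that by blast
qed

lemma quotient_basis_max_ideal_power: "quotient_basis (max_ideal_power d) (low_monos d)"
  unfolding quotient_basis_def
proof (intro conjI allI finite_low_monos)
  fix f
  have iff: "is_coord (max_ideal_power d) (low_monos d) f c \<longleftrightarrow>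
      (\<forall>b. b \<notin> low_monos d \<longrightarrow> c b = 0) \<and> (\<forall>i j. i + j < d \<longrightarrow> c (mono_xy i j) = cf f i j)" for c
    by (auto simp: is_coord_def max_ideal_power_def cf_low_combination)
  obtain c where c: "is_coord (max_ideal_power d) (low_monos d) f c"
    unfolding iff using low_coefficients_exist[of d f] by metis
  moreover have "c' = c" if "is_coord (max_ideal_power d) (low_monos d) f c'" for c'
  proof
    fix b
    show "c' b = c b"
      using that c unfolding iff by (cases "b \<in> low_monos d") (auto simp: low_monos_def)
  qed
  ultimately show "\<exists>!c. is_coord (max_ideal_power d) (low_monos d) f c"
    by blast
qed

text \<open>Otherwise 0 would have two coordinate functions, the zero function and
  \<open>- c\<close> cut off outside \<open>B\<close>; the sign comes from the difference in
  \<open>is_coord\<close>.\<close>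

lemma quotient_basis_independent:
  assumes I: "is_ideal I" and B: "quotient_basis I B"
    and sum: "(\<Sum>b\<in>B. scalar (c b) * b) \<in> I" and b: "b \<in> B"
  shows "c b = 0"
proof -
  define c' where "c' b = (if b \<in> B then - c b else 0)" for b
  have "0 - (\<Sum>b\<in>B. scalar (c' b) * b) = (\<Sum>b\<in>B. scalar (c b) * b)"
    by (simp add: c'_def scalar_minus sum_negf)
  then have "is_coord I B 0 c'"
    using sum by (simp add: is_coord_def c'_def)
  moreover have "is_coord I B 0 (\<lambda>b. 0)"
    using ideal_zero[OF I] by (simp add: is_coord_def)
  ultimately have "c' = (\<lambda>b. 0)"
    using B unfolding quotient_basis_def by blast
  then have "c' b = 0" by simp
  then show ?thesis using b by (simp add: c'_def)
qed

lemma low_chart_reduce: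
  assumes "quotient_basis J (low_monos d)"
  obtains L where "f - L \<in> J" "\<And>i j. d \<le> i + j \<Longrightarrow> cf L i j = 0"
proof -
  obtain c where "is_coord J (low_monos d) f c"
    using assms unfolding quotient_basis_def by blast
  then show ?thesis
    using that[of "\<Sum>b\<in>low_monos d. scalar (c b) * b"]
    by (auto simp: is_coord_def cf_low_combination)
qed

text \<open>A polynomial of degree below \<open>d\<close> is itself a combination of
  \<open>low_monos d\<close>, whose classes are independent modulo \<open>J\<close>.\<close>

lemma low_chart_zero:
  assumes J: "is_ideal J" and B: "quotient_basis J (low_monos d)"
    and f: "f \<in> J" and low: "\<And>i j. d \<le> i + j \<Longrightarrow> cf f i j = 0"
  shows "f = 0"
proof -
  obtain c where c: "\<And>i j. i + j < d \<Longrightarrow> c (mono_xy i j) = cf f i j"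
    using low_coefficients_exist[of d f] by metis
  have eq: "f = (\<Sum>b\<in>low_monos d. scalar (c b) * b)"
    by (rule bipoly_eqI) (simp add: cf_low_combination c low)
  then have "c b = 0" if "b \<in> low_monos d" for b
    using quotient_basis_independent[OF J B _ that] f by simp
  then show ?thesis
    by (subst eq) simp
qed

text \<open>
  Modulo \<open>J\<close>, a monomial \<open>x ^ a * y ^ (d - a)\<close> equals a polynomial \<open>L a\<close> of degree less than
  \<open>d\<close>, by invariance under \<open>- 1\<close> even less than \<open>d - 1\<close>. Hence the syzygy
  \<open>x * L a - y * L (a + 1) \<in> J\<close> has degree less than \<open>d\<close> and vanishes identically, which leaves
  no room for a nonzero \<open>L a\<close>.
\<close>

lemma low_chart_minus_one_fixed:
  assumes J: "is_ideal J" and B: "quotient_basis J (low_monos d)"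
    and fixed: "\<And>f. f \<in> J \<Longrightarrow> bipoly_subst (- var_x) (- var_y) f \<in> J"
  shows "J = max_ideal_power d"
proof
  have "\<exists>L. mono_xy a (d - a) - L \<in> J \<and> (\<forall>i j. d \<le> i + j \<longrightarrow> cf L i j = 0)" for a
    using low_chart_reduce[OF B] by metis
  then obtain L where L: "\<And>a. mono_xy a (d - a) - L a \<in> J"
    and L_low: "\<And>a i j. d \<le> i + j \<Longrightarrow> cf (L a) i j = 0"
    by metis
  have L_lower: "cf (L a) i j = 0" if "d \<le> Suc (i + j)" "a \<le> d" for a i j
  proof (cases "d \<le> i + j")
    case False
    then have d: "d = Suc (i + j)" using that by simp
    let ?s = "bipoly_subst (- var_x) (- var_y)"
    \<comment> \<open>The monomial of degree \<open>d\<close> is an eigenvector with sign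
      \<open>(- 1) ^ d\<close> and cancels. What remains has degree below \<open>d\<close>, so it
      vanishes, and with it every coefficient of \<open>L a\<close> of parity opposite to
      \<open>d\<close>.\<close>
    define R where "R = ?s (mono_xy a (d - a) - L a) - scalar ((- 1) ^ d) * (mono_xy a (d - a) - L a)"
    have cf_R: "cf R k l = ((- 1) ^ d - (- 1) ^ (k + l)) * cf (L a) k l" for k l
      unfolding R_def coeff_diff cf_scalar_mult cf_subst_minus cf_mono_xy
      using that(2) by (auto simp: algebra_simps)
    have "R \<in> J"
      unfolding R_def by (intro ideal_diff ideal_mult J fixed L)
    then have "R = 0"
      by (rule low_chart_zero[OF J B]) (simp add: cf_R L_low)
    then have "cf R i j = 0" by simp
    then show ?thesis unfolding cf_R by (simp add: d)
  qed (rule L_low)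
  have cf_x: "cf (var_x * f) i j = (case i of 0 \<Rightarrow> 0 | Suc i \<Rightarrow> cf f i j)" for f i j
    by (simp add: var_x_def coeff_pCons split: nat.splits)
  have cf_y: "cf (var_y * f) i j = (case j of 0 \<Rightarrow> 0 | Suc j \<Rightarrow> cf f i j)" for f i j
    by (simp add: var_y_def coeff_pCons split: nat.splits)
  have syzygy: "var_x * L a = var_y * L (Suc a)" if "a < d" for a
  proof -
    have "var_x * mono_xy a (d - a) = var_y * mono_xy (Suc a) (d - Suc a)"
      using that by (simp add: mono_xy_def Suc_diff_Suc[symmetric] mult_ac)
    then have "var_x * L a - var_y * L (Suc a) =
        var_y * (mono_xy (Suc a) (d - Suc a) - L (Suc a)) - var_x * (mono_xy a (d - a) - L a)"
      by (simp add: right_diff_distrib)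
    also have "\<dots> \<in> J"
      by (intro ideal_diff ideal_mult J L)
    finally have "var_x * L a - var_y * L (Suc a) = 0"
      by (rule low_chart_zero[OF J B])
        (use that in \<open>auto simp: cf_x cf_y L_lower split: nat.splits\<close>)
    then show ?thesis by simp
  qed
  have right: "cf (L a) i (Suc j) = cf (L (Suc a)) (Suc i) j" if "a < d" for a i j
    using arg_cong[OF syzygy[OF that], of "\<lambda>f. cf f (Suc i) (Suc j)"] by (simp add: cf_x cf_y)
  have edge_y: "cf (L a) i 0 = 0" if "a < d" for a i
    using arg_cong[OF syzygy[OF that], of "\<lambda>f. cf f (Suc i) 0"] by (simp add: cf_x cf_y)
  have edge_x: "cf (L (Suc a)) 0 j = 0" if "a < d" for a j
    using arg_cong[OF syzygy[OF that], of "\<lambda>f. cf f 0 (Suc j)"] by (simp add: cf_x cf_y)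
  \<comment> \<open>The relation \<open>right\<close> moves (a, i, j) to (a + 1, i + 1, j - 1); if
    \<open>a + j < d\<close>, the y-exponent reaches 0 at an index still below \<open>d\<close>,
    where \<open>edge_y\<close> applies.\<close>
  have zero_y: "cf (L a) i j = 0" if "a + j < d" for a i j
    using that by (induction j arbitrary: a i) (simp_all add: edge_y right)
  \<comment> \<open>Walking the other way, the x-exponent reaches 0 at an index still positive,
    where \<open>edge_x\<close> applies.\<close>
  have zero_x: "cf (L a) i j = 0" if "i < a" "a \<le> d" for a i j
    using that
  proof (induction i arbitrary: a j)
    case 0
    then show ?case using edge_x[of "a - 1" j] by simp
  next
    case (Suc i)
    then show ?case using right[of "a - 1" i j] Suc.IH[of "a - 1" "Suc j"] by simp
  qed
  have "L a = 0" if "a \<le> d" for a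
  proof (rule bipoly_eqI)
    fix i j
    \<comment> \<open>If the first two alternatives fail, then i < d - j and d - j \<le> a.\<close>
    consider "d \<le> i + j" | "a + j < d" | "i < a" by linarith
    then show "cf (L a) i j = cf 0 i j"
      using L_low zero_x zero_y that by cases auto
  qed
  then have "mono_xy i j \<in> J" if "i + j = d" for i j
    using L[of i] that by auto
  then show *: "max_ideal_power d \<subseteq> J"
    by (rule max_ideal_power_subset[OF J])
  show "J \<subseteq> max_ideal_power d"
  proof
    fix f assume "f \<in> J"
    \<comment> \<open>\<open>L\<close> is the part of \<open>f\<close> below degree
      \<open>d\<close>; the inclusion just shown puts it into \<open>J\<close>, which forces it to
      be 0.\<close>
    obtain L where L: "f - L \<in> max_ideal_power d" "\<And>i j. d \<le> i + j \<Longrightarrow> cf L i j = 0"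
      using low_chart_reduce[OF quotient_basis_max_ideal_power] by metis
    have "f - (f - L) \<in> J"
      by (rule ideal_diff[OF J \<open>f \<in> J\<close>]) (use L(1) * in blast)
    then have "L = 0"
      using L(2) by (intro low_chart_zero[OF J B]) simp_all
    then show "f \<in> max_ideal_power d" using L(1) by simp
  qed
qed

text \<open>Invariance of dimension without a quotient space: each \<open>b\<close> is replaced by
  its representative in the span of \<open>C\<close>, and these stay independent because they agree
  with \<open>B\<close> modulo \<open>I\<close>.\<close>

lemma quotient_basis_card_le:
  assumes I: "is_ideal I" and B: "quotient_basis I B" and C: "quotient_basis I C"
  shows "card B \<le> card C"
proof -
  interpret vector_space "\<lambda>a f :: bipoly. scalar a * f"
    by unfold_locales (simp_all add: scalar_add scalar_mult algebra_simps)
  have fin: "finite B" "finite C"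
    using B C by (simp_all add: quotient_basis_def)
  have "\<exists>p. is_coord I C b p" for b
    using C unfolding quotient_basis_def by blast
  then obtain p where p: "\<And>b. is_coord I C b (p b)"
    by metis
  define \<pi> where "\<pi> b = (\<Sum>c\<in>C. scalar (p b c) * c)" for b
  have \<pi>: "b - \<pi> b \<in> I" for b
    using p[of b] by (simp add: is_coord_def \<pi>_def)
  have indep: "u b = 0" if "(\<Sum>b\<in>B. scalar (u b) * \<pi> b) = 0" "b \<in> B" for u b
  proof -
    have "(\<Sum>b\<in>B. scalar (u b) * (b - \<pi> b)) \<in> I"
      by (intro ideal_sum ideal_mult I \<pi>)
    then have "(\<Sum>b\<in>B. scalar (u b) * b) \<in> I"
      using that(1) by (simp add: right_diff_distrib sum_subtractf)
    from quotient_basis_independent[OF I B this that(2)] show ?thesis .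
  qed
  have inj: "inj_on \<pi> B"
  proof (rule inj_onI, rule ccontr)
    fix b b' assume b: "b \<in> B" "b' \<in> B" "\<pi> b = \<pi> b'" "b \<noteq> b'"
    define u where "u x = (if x = b then 1 else if x = b' then - 1 else 0 :: complex)" for x
    have "(\<Sum>x\<in>B. scalar (u x) * \<pi> x) = (\<Sum>x\<in>{b, b'}. scalar (u x) * \<pi> x)"
      using b fin by (intro sum.mono_neutral_right) (auto simp: u_def)
    also have "\<dots> = 0"
      using b by (simp add: u_def scalar_minus)
    finally have "u b = 0" using indep b(1) by blast
    then show False by (simp add: u_def)
  qed
  have "independent (\<pi> ` B)"
  proof (rule independent_if_scalars_zero)
    fix u v assume "(\<Sum>x\<in>\<pi> ` B. scalar (u x) * x) = 0" "v \<in> \<pi> ` B"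
    then show "u v = 0"
      using indep[of "\<lambda>b. u (\<pi> b)"] by (auto simp: sum.reindex[OF inj])
  qed (use fin in simp)
  moreover have "\<pi> ` B \<subseteq> span C"
  proof (rule image_subsetI)
    show "\<pi> b \<in> span C" for b
      unfolding \<pi>_def by (intro span_sum span_scale span_base)
  qed
  ultimately have "card (\<pi> ` B) \<le> card C"
    using independent_span_bound[OF fin(2)] by blast
  then show ?thesis by (simp add: card_image[OF inj])
qed


section \<open>Topology of the fixed locus\<close>

lemma openin_hilb:
  assumes "finite B" "card B = n" "\<phi> \<in> chart_functions B"
  shows "openin (hilb n) {I \<in> hilb_chart B. \<phi> I \<noteq> 0}"
  unfolding hilb_def by (rule topology_generated_by_Basis) (use assms in blast)

lemma openin_hilb_chart:
  assumes "finite B" "card B = n"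
  shows "openin (hilb n) (hilb_chart B)"
  using openin_hilb[OF assms chart_functions.const[of 1]] by simp

lemma topspace_hilb: "topspace (hilb n) = hilb_points n"
proof
  show "topspace (hilb n) \<subseteq> hilb_points n"
    unfolding hilb_def topology_generated_by_topspace
    by (auto simp: hilb_chart_def hilb_points_def)
  show "hilb_points n \<subseteq> topspace (hilb n)"
  proof
    fix I assume "I \<in> hilb_points n"
    then obtain B where "I \<in> hilb_chart B" "finite B" "card B = n"
      by (auto simp: hilb_points_def hilb_chart_def quotient_basis_def)
    then show "I \<in> topspace (hilb n)"
      using openin_subset[OF openin_hilb_chart] by blast
  qed
qed

lemma is_coord_coord:
  assumes "quotient_basis I B"
  shows "is_coord I B f (coord B I f)"
  using assms theI'[of "is_coord I B f"] unfolding quotient_basis_def coord_def by blast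

lemma mem_ideal_iff_coord:
  assumes "is_ideal I" "quotient_basis I B"
  shows "f \<in> I \<longleftrightarrow> (\<forall>b\<in>B. coord B I f b = 0)"
proof
  assume "f \<in> I"
  then have "is_coord I B f (\<lambda>b. 0)" by (simp add: is_coord_def)
  then have "coord B I f = (\<lambda>b. 0)"
    using assms(2) is_coord_coord[OF assms(2)] unfolding quotient_basis_def by blast
  then show "\<forall>b\<in>B. coord B I f b = 0" by simp
next
  assume "\<forall>b\<in>B. coord B I f b = 0"
  then show "f \<in> I"
    using is_coord_coord[OF assms(2), of f] by (simp add: is_coord_def)
qed

text \<open>Within one chart an ideal is the common kernel of its coordinates, so distinct ideals
  differ in some coordinate. An ideal outside the chart is separated by the chart itself.\<close>

lemma t1_space_hilb: "t1_space (hilb n)"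
  unfolding t1_space_def topspace_hilb
proof (intro ballI impI)
  fix J I assume J: "J \<in> hilb_points n" and I: "I \<in> hilb_points n" and "J \<noteq> I"
  obtain B where B: "finite B" "card B = n" "J \<in> hilb_chart B"
    using J by (auto simp: hilb_points_def hilb_chart_def quotient_basis_def)
  show "\<exists>U. openin (hilb n) U \<and> J \<in> U \<and> I \<notin> U"
  proof (cases "I \<in> hilb_chart B")
    case True
    have "\<exists>f. \<exists>b\<in>B. coord B J f b \<noteq> coord B I f b"
    proof (rule ccontr)
      assume "\<not> ?thesis"
      then have "f \<in> J \<longleftrightarrow> f \<in> I" for f
        using True B(3) mem_ideal_iff_coord[of J B f] mem_ideal_iff_coord[of I B f]
        by (simp add: hilb_chart_def)
      then show False using \<open>J \<noteq> I\<close> by blast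
    qed
    then obtain f b where b: "b \<in> B" "coord B J f b \<noteq> coord B I f b" by blast
    \<comment> \<open>The value at the fixed ideal \<open>I\<close> is a constant, so this is a
      chart function that vanishes at \<open>I\<close> but not at \<open>J\<close>.\<close>
    define \<phi> where "\<phi> K = coord B K f b + - coord B I f b" for K
    have "\<phi> \<in> chart_functions B"
      unfolding \<phi>_def by (intro chart_functions.intros b)
    then show ?thesis
      using openin_hilb[OF B(1,2)] B(3) b(2) by (auto simp: \<phi>_def intro!: exI[of _ "{K \<in> hilb_chart B. \<phi> K \<noteq> 0}"])
  qed (use B openin_hilb_chart in blast)
qed

section \<open>Components and dimension at an isolated point\<close>

lemma irreducible_in_singleton: "x \<in> topspace X \<Longrightarrow> irreducible_in X {x}"
  unfolding irreducible_in_def by blast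

text \<open>The point and its complement are closed and cover every irreducible set through
  \<open>x\<close>, which must therefore lie in \<open>{x}\<close>.\<close>

lemma clopen_point_irreducible_component:
  assumes "openin X {x}" "closedin X {x}"
  shows "irreducible_component X Z \<and> x \<in> Z \<longleftrightarrow> Z = {x}"
proof -
  have x: "x \<in> topspace X"
    using assms(1) openin_subset by blast
  have eq: "S = {x}" if "irreducible_in X S" "x \<in> S" for S
  proof -
    have "closedin X (topspace X - {x})"
      using assms(1) by (simp add: openin_closedin_eq)
    moreover have "S \<subseteq> {x} \<union> (topspace X - {x})"
      using that(1) unfolding irreducible_in_def by blast
    ultimately have "S \<subseteq> {x} \<or> S \<subseteq> topspace X - {x}"
      using that(1) assms(2) unfolding irreducible_in_def by metis
    then show ?thesis using that(2) by blast
  qed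
  then show ?thesis
    using irreducible_in_singleton[OF x] unfolding irreducible_component_def by (metis insertCI subsetD)
qed

lemma krull_dim_singleton: "krull_dim (subtopology X {x}) = 0"
proof -
  have "k = 0" if Z: "\<forall>i\<le>k. irreducible_in (subtopology X {x}) (Z i)" "\<forall>i<k. Z i \<subset> Z (Suc i)"
    for k and Z :: "nat \<Rightarrow> 'a set"
  proof (rule ccontr)
    assume "k \<noteq> 0"
    then have "irreducible_in (subtopology X {x}) (Z 0)" "irreducible_in (subtopology X {x}) (Z 1)"
      "Z 0 \<subset> Z 1"
      using Z by auto
    then have "Z 0 \<noteq> {}" "Z 1 \<subseteq> topspace (subtopology X {x})" "Z 0 \<subset> Z 1"
      unfolding irreducible_in_def by blast+
    then show False
      unfolding topspace_subtopology by blast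
  qed
  then have "krull_dim (subtopology X {x}) \<le> 0"
    unfolding krull_dim_def by (intro Sup_least) (auto simp: zero_enat_def)
  then show ?thesis by simp
qed

lemma max_ideal_power_clopen:
  assumes I: "max_ideal_power d \<in> hilb_fixed_points n G" and G: "- mat 1 \<in> G"
  shows "openin (hilb_fixed n G) {max_ideal_power d}" "closedin (hilb_fixed n G) {max_ideal_power d}"
proof -
  let ?I = "max_ideal_power d" and ?B = "low_monos d"
  obtain C where ideal: "is_ideal ?I" and C: "quotient_basis ?I C" "card C = n"
    using I by (auto simp: hilb_fixed_points_def hilb_points_def)
  note B = quotient_basis_max_ideal_power[of d]
  \<comment> \<open>Membership in \<open>hilb_points n\<close> supplies some basis of size
    \<open>n\<close>; the chart is open in \<open>hilb n\<close> once \<open>low_monos d\<close> has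
    that size too.\<close>
  have "card ?B = n"
    using quotient_basis_card_le[OF ideal B C(1)] quotient_basis_card_le[OF ideal C(1) B] C(2) by simp
  then have "openin (hilb_fixed n G) (hilb_fixed_points n G \<inter> hilb_chart ?B)"
    unfolding hilb_fixed_def
    by (rule openin_subtopology_Int2[OF openin_hilb_chart[OF finite_low_monos]])
  also have "hilb_fixed_points n G \<inter> hilb_chart ?B = {?I}"
  proof -
    have "J = ?I" if "J \<in> hilb_fixed_points n G" "J \<in> hilb_chart ?B" for J
    proof (rule low_chart_minus_one_fixed)
      show "is_ideal J" "quotient_basis J ?B"
        using that(2) by (simp_all add: hilb_chart_def)
      fix f assume "f \<in> J"
      then have "act_poly (- mat 1) f \<in> J"
        using that(1) G by (auto simp: hilb_fixed_points_def)
      then show "bipoly_subst (- var_x) (- var_y) f \<in> J"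
        by (simp add: act_poly_minus_one)
    qed
    then show ?thesis
      using I ideal B unfolding hilb_chart_def by blast
  qed
  finally show "openin (hilb_fixed n G) {?I}" .
  then have "?I \<in> topspace (hilb_fixed n G)"
    using openin_subset by blast
  moreover have "t1_space (hilb_fixed n G)"
    unfolding hilb_fixed_def by (intro t1_space_subtopology t1_space_hilb)
  ultimately show "closedin (hilb_fixed n G) {?I}"
    by (simp add: closedin_t1_singleton)
qed


section \<open>The central involution\<close>

text \<open>Trace 0 and determinant 1 would give A^2 = - 1. So the trace is nonzero, the
  off-diagonal entries of A^2 force \<open>A\<close> to be diagonal, and determinant 1 makes it
  scalar.\<close>

lemma involution_SL2:
  fixes A :: "complex^2^2"
  assumes "det A = 1" "A ** A = mat 1" "A \<noteq> mat 1"
  shows "A = - mat 1"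
proof -
  define a b c d where "a = A $ 1 $ 1" and "b = A $ 1 $ 2" and "c = A $ 2 $ 1" and "d = A $ 2 $ 2"
  have det: "a * d - b * c = 1"
    using assms(1) by (simp add: det_2 a_def b_def c_def d_def)
  have sq: "a * a + b * c = 1" "a * b + b * d = 0" "c * a + d * c = 0" "c * b + d * d = 1"
    using assms(2)
    by (simp_all add: vec_eq_iff forall_2 matrix_matrix_mult_def sum_2 mat_def a_def b_def c_def d_def)
  have "a + d \<noteq> 0"
  proof
    assume "a + d = 0"
    then have "d = - a" by (simp add: eq_neg_iff_add_eq_0 add.commute)
    then have "a * d - b * c = - (a * a + b * c)" by simp
    then show False using det sq(1) by simp
  qed
  moreover have "b * (a + d) = 0" "c * (a + d) = 0"
    using sq(2,3) by (simp_all add: algebra_simps)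
  ultimately have bc: "b = 0" "c = 0" by auto
  have "a \<noteq> 0" using det bc by auto
  have "a = d"
  proof -
    have "a * a = a * d" using det sq(1) bc by simp
    then show ?thesis using \<open>a \<noteq> 0\<close> by simp
  qed
  have "a = 1 \<or> a = - 1"
    using sq(1) bc by (simp add: square_eq_1_iff)
  moreover have "a \<noteq> 1"
  proof
    assume "a = 1"
    then have "A = mat 1"
      using \<open>a = d\<close> bc by (simp add: vec_eq_iff forall_2 mat_def a_def b_def c_def d_def)
    then show False using assms(3) by contradiction
  qed
  ultimately have "a = - 1" by blast
  then show ?thesis
    using \<open>a = d\<close> bc by (simp add: vec_eq_iff forall_2 mat_def a_def b_def c_def d_def)
qed

lemma minus_one_mult: "- mat 1 ** A = - (A :: complex^2^2)" "A ** - mat 1 = - (A :: complex^2^2)"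
  by (simp_all add: vec_eq_iff forall_2 matrix_matrix_mult_def sum_2 mat_def)

text \<open>Conjugation by - 1 is trivial: it lies in the kernel of the double cover and so
  preserves every \<open>V\<close>.\<close>

lemma minus_one_in_binary_group: "- mat 1 \<in> binary_group V"
proof -
  have adj: "adjoint_matrix (- mat 1) = - mat 1"
    by (simp add: adjoint_matrix_def vec_eq_iff forall_2 mat_def)
  have "- mat 1 \<in> SU2"
    unfolding SU2_def mem_Collect_eq adj minus_one_mult by (simp add: det_2 mat_def)
  moreover have "- mat 1 ** pauli v ** adjoint_matrix (- mat 1) = pauli v" for v
    by (simp add: adj minus_one_mult)
  ultimately show ?thesis
    by (simp add: binary_group_def)
qed

text \<open>The preimage of - 1 under the isomorphism is an involution of determinant 1, hence again
  - 1.\<close>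

lemma minus_one_in_subgroup:
  assumes "subgroup G SL2" and iso: "SL2\<lparr>carrier := G\<rparr> \<cong> SL2\<lparr>carrier := binary_group V\<rparr>"
  shows "- mat 1 \<in> G"
proof -
  interpret subgroup G SL2 by fact
  obtain h where h_mult: "\<And>A B. A \<in> G \<Longrightarrow> B \<in> G \<Longrightarrow> h (A ** B) = h A ** h B"
    and bij: "bij_betw h G (binary_group V)"
    using iso by (auto simp: is_iso_def iso_def hom_def SL2_def)
  have one: "mat 1 \<in> G" and det: "\<And>A. A \<in> G \<Longrightarrow> det A = 1"
    and closed: "\<And>A B. A \<in> G \<Longrightarrow> B \<in> G \<Longrightarrow> A ** B \<in> G"
    using one_closed subset m_closed by (auto simp: SL2_def)
  \<comment> \<open>The image of 1 is idempotent, and as a unitary matrix it can be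
    cancelled.\<close>
  have h_one: "h (mat 1) = mat 1"
  proof -
    let ?e = "h (mat 1)"
    have "?e \<in> SU2"
      using bij one by (auto simp: bij_betw_def binary_group_def)
    then have inv: "?e ** adjoint_matrix ?e = mat 1"
      by (simp add: SU2_def)
    have "?e ** ?e = ?e"
      using h_mult[OF one one] by simp
    then have "?e ** (?e ** adjoint_matrix ?e) = ?e ** adjoint_matrix ?e"
      by (simp add: matrix_mul_assoc)
    then show ?thesis using inv by simp
  qed
  obtain A where A: "A \<in> G" "h A = - mat 1"
    using bij minus_one_in_binary_group unfolding bij_betw_def by (metis imageE)
  have "h (A ** A) = h (mat 1)"
    using h_mult[OF A(1) A(1)] by (simp add: A(2) minus_one_mult h_one)
  then have "A ** A = mat 1"
    using bij closed[OF A(1) A(1)] one by (auto simp: bij_betw_def inj_on_def)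
  moreover have "A \<noteq> mat 1"
  proof
    assume "A = mat 1"
    then have "(mat 1 :: complex^2^2) = - mat 1"
      using A(2) h_one by simp
    then show False
      unfolding vec_eq_iff forall_2 by (simp add: mat_def)
  qed
  ultimately have "A = - mat 1"
    using involution_SL2 det[OF A(1)] by blast
  then show ?thesis using A(1) by simp
qed

theorem theorem2:
  fixes \<Gamma> :: "(complex^2^2) set" and n :: nat and I :: "bipoly set"
  assumes "subgroup \<Gamma> SL2" and "finite \<Gamma>"
    and "SL2\<lparr>carrier := \<Gamma>\<rparr> \<cong> SL2\<lparr>carrier := binary_group tetrahedron\<rparr> \<or>
         SL2\<lparr>carrier := \<Gamma>\<rparr> \<cong> SL2\<lparr>carrier := binary_group octahedron\<rparr> \<or>
         SL2\<lparr>carrier := \<Gamma>\<rparr> \<cong> SL2\<lparr>carrier := binary_group icosahedron\<rparr>"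
    and "I \<in> hilb_fixed_points n (carrier SL2)"
  shows "(\<exists>!Z. irreducible_component (hilb_fixed n \<Gamma>) Z \<and> I \<in> Z) \<and>
    (\<forall>Z. irreducible_component (hilb_fixed n \<Gamma>) Z \<and> I \<in> Z \<longrightarrow>
      krull_dim (subtopology (hilb_fixed n \<Gamma>) Z) = 0)"
proof -
  have minus_one: "- mat 1 \<in> \<Gamma>"
    using assms(1,3) minus_one_in_subgroup by blast
  obtain d where d: "I = max_ideal_power d"
    using SL2_fixed_eq_max_ideal_power[OF assms(4)] .
  have "\<Gamma> \<subseteq> carrier SL2"
    using assms(1) by (rule subgroup.subset)
  then have "I \<in> hilb_fixed_points n \<Gamma>"
    using assms(4) by (auto simp: hilb_fixed_points_def)
  then have "irreducible_component (hilb_fixed n \<Gamma>) Z \<and> I \<in> Z \<longleftrightarrow> Z = {I}" for Z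
    unfolding d using max_ideal_power_clopen[OF _ minus_one]
    by (intro clopen_point_irreducible_component) auto
  then show ?thesis
    using krull_dim_singleton by simp
qed

end
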